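(* Let $X = V(I)\subseteq\mathbb{P}^n$ be a projectively normal, well-poised variety over $\mathbb{C}$ and let $d\ge1$. Then the $d$-th Veronese embedding of $X$ in $\mathbb{P}^{\binom{n+d}{d}-1}$ is also a well-poised embedding. That is, if $J\subseteq\mathbb{C}[y_a : a\in\mathbb{Z}_{\ge0}^{n+1},\ \sum_i a_i=d]$ is the kernel of the map $y_a\mapsto x^a$ to $\mathbb{C}[x_0,\dots,x_n]/I$, then $J$ is well-poised.
   Context: For $w$ real, $\mathrm{in}_w(f)$ is the sum of terms of $f$ of minimal $w$-weight, $\mathrm{in}_w(I)=\langle\mathrm{in}_w(f):f\in I\rangle$, and $\mathrm{Trop}(I)$ is the set of $w$ such that $\mathrm{in}_w(I)$ contains no monomial. A prime ideal $I$ of a polynomial ring over $\mathbb{C}$ containing no variable is well-poised if $\mathrm{in}_w(I)$ is prime for every $w\in\mathrm{Trop}(I)$. A projective variety $X=V(I)\subseteq\mathbb{P}^n$, not contained in a coordinate hyperplane, with $I$ its homogeneous prime ideal, is well-poised if $I\subseteq\mathbb{C}[x_0,\dots,x_n]$ is well-poised. Projectively normal means that $\mathbb{C}[x_0,\dots,x_n]/I$ is a normal domain. *)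

theory Defs
  imports
    Complex_Main
    "HOL-Library.FuncSet"
    "HOL-Library.Poly_Mapping"
    "HOL-Algebra.QuotRing"
    "HOL-Algebra.Polynomials"
begin

section \<open>Polynomial rings over the complex numbers\<close>

text \<open>
  Exponent vectors are finitely supported functions from the variables to \<^typ>\<open>nat\<close>; a polynomial is
  a finitely supported function from exponent vectors to \<^typ>\<open>complex\<close>. The set \<open>V\<close> of
  variables is a parameter, so that the number of variables can depend on other data.
\<close>

type_synonym 'v cmpoly = "('v \<Rightarrow>\<^sub>0 nat) \<Rightarrow>\<^sub>0 complex"

definition monomial :: "('v \<Rightarrow>\<^sub>0 nat) \<Rightarrow> 'v cmpoly" where
  "monomial m = Poly_Mapping.single m 1"

definition const_poly :: "complex \<Rightarrow> 'v cmpoly" where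
  "const_poly c = Poly_Mapping.single 0 c"

definition variable :: "'v \<Rightarrow> 'v cmpoly" where
  "variable v = monomial (Poly_Mapping.single v 1)"

definition mpoly_ring :: "'v set \<Rightarrow> 'v cmpoly ring" where
  "mpoly_ring V =
     \<lparr>carrier = {f. \<forall>m\<in>Poly_Mapping.keys f. Poly_Mapping.keys m \<subseteq> V},
      mult = (*), one = 1, zero = 0, add = (+)\<rparr>"

lemma mpoly_ring_simps [simp]:
  "mult (mpoly_ring V) = (*)" "one (mpoly_ring V) = 1"
  "zero (mpoly_ring V) = 0" "add (mpoly_ring V) = (+)"
  by (simp_all add: mpoly_ring_def)

lemma mem_mpoly_ring:
  "f \<in> carrier (mpoly_ring V) \<longleftrightarrow> (\<forall>m\<in>Poly_Mapping.keys f. Poly_Mapping.keys m \<subseteq> V)"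
  by (simp add: mpoly_ring_def)

lemma mpoly_ring_add_closed:
  "f \<in> carrier (mpoly_ring V) \<Longrightarrow> g \<in> carrier (mpoly_ring V) \<Longrightarrow> f + g \<in> carrier (mpoly_ring V)"
  using Poly_Mapping.keys_add[of f g] by (auto simp: mem_mpoly_ring)

lemma mpoly_ring_mult_closed:
  assumes "f \<in> carrier (mpoly_ring V)" "g \<in> carrier (mpoly_ring V)"
  shows "f * g \<in> carrier (mpoly_ring V)"
proof -
  have "Poly_Mapping.keys m \<subseteq> V" if "m \<in> Poly_Mapping.keys (f * g)" for m
  proof -
    obtain a b where "m = a + b" "a \<in> Poly_Mapping.keys f" "b \<in> Poly_Mapping.keys g"
      using \<open>m \<in> Poly_Mapping.keys (f * g)\<close> Poly_Mapping.keys_mult[of f g] by blast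
    then show ?thesis
      using Poly_Mapping.keys_add[of a b] assms by (fastforce simp: mem_mpoly_ring)
  qed
  then show ?thesis by (simp add: mem_mpoly_ring)
qed

lemma cring_mpoly_ring: "cring (mpoly_ring V)"
proof (rule cringI)
  show "abelian_group (mpoly_ring V)"
  proof (rule abelian_groupI)
    show "\<exists>y\<in>carrier (mpoly_ring V). y \<oplus>\<^bsub>mpoly_ring V\<^esub> x = \<zero>\<^bsub>mpoly_ring V\<^esub>"
      if "x \<in> carrier (mpoly_ring V)" for x
      using that by (intro bexI[of _ "- x"]) (auto simp: mem_mpoly_ring)
  qed (simp_all add: mpoly_ring_add_closed mem_mpoly_ring[of 0] add.assoc add.commute)
  show "comm_monoid (mpoly_ring V)"
    by (rule comm_monoidI)
       (simp_all add: mpoly_ring_mult_closed mem_mpoly_ring[of 1] mult.assoc mult.commute)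
qed (simp add: distrib_right)


section \<open>Homogeneous ideals\<close>

definition total_degree :: "('v \<Rightarrow>\<^sub>0 nat) \<Rightarrow> nat" where
  "total_degree m = (\<Sum>v\<in>Poly_Mapping.keys m. Poly_Mapping.lookup m v)"

definition homogeneous_component :: "nat \<Rightarrow> 'v cmpoly \<Rightarrow> 'v cmpoly" where
  "homogeneous_component k f =
     (\<Sum>m\<in>{m \<in> Poly_Mapping.keys f. total_degree m = k}.
        Poly_Mapping.single m (Poly_Mapping.lookup f m))"

definition homogeneous_prime_ideal :: "'v set \<Rightarrow> 'v cmpoly set \<Rightarrow> bool" where
  "homogeneous_prime_ideal V I \<longleftrightarrow>
     primeideal I (mpoly_ring V) \<and> (\<forall>f\<in>I. \<forall>k. homogeneous_component k f \<in> I)"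


section \<open>Initial ideals, tropical varieties and well-poised ideals\<close>

definition weight :: "('v \<Rightarrow> real) \<Rightarrow> ('v \<Rightarrow>\<^sub>0 nat) \<Rightarrow> real" where
  "weight w m = (\<Sum>v\<in>Poly_Mapping.keys m. real (Poly_Mapping.lookup m v) * w v)"

definition initial_form :: "('v \<Rightarrow> real) \<Rightarrow> 'v cmpoly \<Rightarrow> 'v cmpoly" where
  "initial_form w f =
     (\<Sum>m\<in>{m \<in> Poly_Mapping.keys f. \<forall>m'\<in>Poly_Mapping.keys f. weight w m \<le> weight w m'}.
        Poly_Mapping.single m (Poly_Mapping.lookup f m))"

definition initial_ideal :: "'v set \<Rightarrow> ('v \<Rightarrow> real) \<Rightarrow> 'v cmpoly set \<Rightarrow> 'v cmpoly set" where
  "initial_ideal V w I = Idl\<^bsub>mpoly_ring V\<^esub> (initial_form w ` I)"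

text \<open>
  Weight vectors are elements of \<open>V \<rightarrow>\<^sub>E UNIV\<close>, i.e. of the real vector space with
  coordinates indexed by \<open>V\<close>. The constant polynomial 1 counts as a monomial.
\<close>

definition Trop :: "'v set \<Rightarrow> 'v cmpoly set \<Rightarrow> ('v \<Rightarrow> real) set" where
  "Trop V I =
     {w \<in> V \<rightarrow>\<^sub>E UNIV.
        \<not> (\<exists>m. Poly_Mapping.keys m \<subseteq> V \<and> monomial m \<in> initial_ideal V w I)}"

definition well_poised :: "'v set \<Rightarrow> 'v cmpoly set \<Rightarrow> bool" where
  "well_poised V I \<longleftrightarrow>
     primeideal I (mpoly_ring V) \<and> (\<forall>v\<in>V. variable v \<notin> I) \<and>
     (\<forall>w\<in>Trop V I. primeideal (initial_ideal V w I) (mpoly_ring V))"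


section \<open>Fraction fields and normal domains\<close>

definition fractions :: "('a, 'b) ring_scheme \<Rightarrow> ('a \<times> 'a) set" where
  "fractions R = carrier R \<times> (carrier R - {\<zero>\<^bsub>R\<^esub>})"

definition fraction_rel :: "('a, 'b) ring_scheme \<Rightarrow> (('a \<times> 'a) \<times> ('a \<times> 'a)) set" where
  "fraction_rel R = {((a, b), (c, d)).
     (a, b) \<in> fractions R \<and> (c, d) \<in> fractions R \<and> a \<otimes>\<^bsub>R\<^esub> d = c \<otimes>\<^bsub>R\<^esub> b}"

definition fraction :: "('a, 'b) ring_scheme \<Rightarrow> 'a \<Rightarrow> 'a \<Rightarrow> ('a \<times> 'a) set" where
  "fraction R a b = fraction_rel R `` {(a, b)}"

text \<open>
  The unions below range over representatives; all members of such a union coincide when \<open>R\<close>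
  is a domain (see \<open>fraction_add\<close> and \<open>fraction_mult\<close>).
\<close>

definition fraction_field :: "('a, 'b) ring_scheme \<Rightarrow> ('a \<times> 'a) set ring" where
  "fraction_field R =
     \<lparr>carrier = fractions R // fraction_rel R,
      mult = (\<lambda>P Q. \<Union>(a, b)\<in>P. \<Union>(c, d)\<in>Q. fraction R (a \<otimes>\<^bsub>R\<^esub> c) (b \<otimes>\<^bsub>R\<^esub> d)),
      one = fraction R \<one>\<^bsub>R\<^esub> \<one>\<^bsub>R\<^esub>,
      zero = fraction R \<zero>\<^bsub>R\<^esub> \<one>\<^bsub>R\<^esub>,
      add = (\<lambda>P Q. \<Union>(a, b)\<in>P. \<Union>(c, d)\<in>Q.
               fraction R (a \<otimes>\<^bsub>R\<^esub> d \<oplus>\<^bsub>R\<^esub> c \<otimes>\<^bsub>R\<^esub> b) (b \<otimes>\<^bsub>R\<^esub> d))\<rparr>"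

definition fraction_embed :: "('a, 'b) ring_scheme \<Rightarrow> 'a \<Rightarrow> ('a \<times> 'a) set" where
  "fraction_embed R a = fraction R a \<one>\<^bsub>R\<^esub>"

text \<open>
  In HOL-Algebra a polynomial is the list of its coefficients, leading coefficient first, and the
  zero polynomial is the empty list.
\<close>

definition integral_over :: "('a, 'b) ring_scheme \<Rightarrow> 'a set \<Rightarrow> 'a \<Rightarrow> bool" where
  "integral_over L K x \<longleftrightarrow>
     (\<exists>p. polynomial\<^bsub>L\<^esub> K p \<and> p \<noteq> [] \<and> Polynomials.lead_coeff p = \<one>\<^bsub>L\<^esub> \<and>
        ring.eval L p x = \<zero>\<^bsub>L\<^esub>)"

definition normal_domain :: "('a, 'b) ring_scheme \<Rightarrow> bool" where
  "normal_domain R \<longleftrightarrow> domain R \<and>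
     (\<forall>x\<in>carrier (fraction_field R).
        integral_over (fraction_field R) (fraction_embed R ` carrier R) x \<longrightarrow>
        x \<in> fraction_embed R ` carrier R)"

context domain
begin

lemma fraction_eq_cancel:
  assumes "a \<in> carrier R" "b \<in> carrier R" "c \<in> carrier R" "c \<noteq> \<zero>" "a \<otimes> c = b \<otimes> c"
  shows "a = b"
  using assms m_rcancel by blast

lemma equiv_fraction_rel: "equiv (fractions R) (fraction_rel R)"
proof (rule equivI)
  show "fraction_rel R \<subseteq> fractions R \<times> fractions R"
    by (auto simp: fraction_rel_def)
  show "refl_on (fractions R) (fraction_rel R)"
    by (auto simp: refl_on_def fraction_rel_def)
  show "sym (fraction_rel R)"
    by (auto simp: sym_def fraction_rel_def)
  show "trans (fraction_rel R)"
  proof (rule transI, clarify)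
    fix a b c d e f
    assume *: "((a, b), (c, d)) \<in> fraction_rel R" "((c, d), (e, f)) \<in> fraction_rel R"
    then have [simp]: "a \<in> carrier R" "b \<in> carrier R" "c \<in> carrier R" "d \<in> carrier R"
        "e \<in> carrier R" "f \<in> carrier R" and nz: "b \<noteq> \<zero>" "d \<noteq> \<zero>" "f \<noteq> \<zero>"
      and eq: "a \<otimes> d = c \<otimes> b" "c \<otimes> f = e \<otimes> d"
      by (auto simp: fraction_rel_def fractions_def)
    have "(a \<otimes> f) \<otimes> d = (a \<otimes> d) \<otimes> f" by (simp add: m_ac)
    also have "\<dots> = (c \<otimes> f) \<otimes> b" by (simp add: eq(1) m_ac)
    also have "\<dots> = (e \<otimes> b) \<otimes> d" by (simp add: eq(2) m_ac)
    finally have "a \<otimes> f = e \<otimes> b" by (rule fraction_eq_cancel[rotated 4]) (use nz in auto)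
    then show "((a, b), (e, f)) \<in> fraction_rel R"
      using nz by (simp add: fraction_rel_def fractions_def)
  qed
qed

lemma fraction_eq_iff:
  assumes "(a, b) \<in> fractions R" "(c, d) \<in> fractions R"
  shows "fraction R a b = fraction R c d \<longleftrightarrow> a \<otimes> d = c \<otimes> b"
  using eq_equiv_class_iff[OF equiv_fraction_rel assms] assms
  by (simp add: fraction_def fraction_rel_def)

lemma fraction_cases:
  assumes "P \<in> carrier (fraction_field R)"
  obtains a b where "(a, b) \<in> fractions R" "P = fraction R a b"
  using assms by (auto simp: fraction_field_def quotient_def fraction_def)

lemma fraction_in_carrier:
  "(a, b) \<in> fractions R \<Longrightarrow> fraction R a b \<in> carrier (fraction_field R)"
  by (auto simp: fraction_field_def fraction_def intro: quotientI)

lemma UN_fraction_const: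
  assumes "p \<in> A" "q \<in> B"
    and "\<And>a b c d. (a, b) \<in> A \<Longrightarrow> (c, d) \<in> B \<Longrightarrow> F a b c d = C"
  shows "(\<Union>(a, b)\<in>A. \<Union>(c, d)\<in>B. F a b c d) = C"
  using assms by (cases p, cases q) fastforce

lemma fraction_mult:
  assumes "(a, b) \<in> fractions R" "(c, d) \<in> fractions R"
  shows "fraction R a b \<otimes>\<^bsub>fraction_field R\<^esub> fraction R c d = fraction R (a \<otimes> c) (b \<otimes> d)"
proof -
  have 1: "fraction R (a' \<otimes> c') (b' \<otimes> d') = fraction R (a \<otimes> c) (b \<otimes> d)"
    if "((a, b), (a', b')) \<in> fraction_rel R" "((c, d), (c', d')) \<in> fraction_rel R" for a' b' c' d'
  proof -
    from that have [simp]: "a \<in> carrier R" "b \<in> carrier R" "c \<in> carrier R" "d \<in> carrier R"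
        "a' \<in> carrier R" "b' \<in> carrier R" "c' \<in> carrier R" "d' \<in> carrier R"
      and nz: "b \<noteq> \<zero>" "d \<noteq> \<zero>" "b' \<noteq> \<zero>" "d' \<noteq> \<zero>"
      and eq: "a \<otimes> b' = a' \<otimes> b" "c \<otimes> d' = c' \<otimes> d"
      by (auto simp: fraction_rel_def fractions_def)
    have "(a' \<otimes> c') \<otimes> (b \<otimes> d) = (a' \<otimes> b) \<otimes> (c' \<otimes> d)" by (simp add: m_ac)
    also have "\<dots> = (a \<otimes> c) \<otimes> (b' \<otimes> d')" by (simp add: eq[symmetric] m_ac)
    finally show ?thesis
      using nz by (subst fraction_eq_iff) (auto simp: fractions_def integral_iff)
  qed
  have "(a, b) \<in> fraction R a b" "(c, d) \<in> fraction R c d"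
    using assms by (auto simp: fraction_def fraction_rel_def)
  then have "(\<Union>(a', b')\<in>fraction R a b. \<Union>(c', d')\<in>fraction R c d. fraction R (a' \<otimes> c') (b' \<otimes> d')) =
      fraction R (a \<otimes> c) (b \<otimes> d)"
    by (intro UN_fraction_const[OF _ _ 1]) (auto simp: fraction_def)
  then show ?thesis by (simp add: fraction_field_def)
qed

lemma fraction_add:
  assumes "(a, b) \<in> fractions R" "(c, d) \<in> fractions R"
  shows "fraction R a b \<oplus>\<^bsub>fraction_field R\<^esub> fraction R c d =
    fraction R (a \<otimes> d \<oplus> c \<otimes> b) (b \<otimes> d)"
proof -
  have 1: "fraction R (a' \<otimes> d' \<oplus> c' \<otimes> b') (b' \<otimes> d') = fraction R (a \<otimes> d \<oplus> c \<otimes> b) (b \<otimes> d)"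
    if "((a, b), (a', b')) \<in> fraction_rel R" "((c, d), (c', d')) \<in> fraction_rel R" for a' b' c' d'
  proof -
    from that have [simp]: "a \<in> carrier R" "b \<in> carrier R" "c \<in> carrier R" "d \<in> carrier R"
        "a' \<in> carrier R" "b' \<in> carrier R" "c' \<in> carrier R" "d' \<in> carrier R"
      and nz: "b \<noteq> \<zero>" "d \<noteq> \<zero>" "b' \<noteq> \<zero>" "d' \<noteq> \<zero>"
      and eq: "a \<otimes> b' = a' \<otimes> b" "c \<otimes> d' = c' \<otimes> d"
      by (auto simp: fraction_rel_def fractions_def)
    have "(a' \<otimes> d' \<oplus> c' \<otimes> b') \<otimes> (b \<otimes> d) =
        (a' \<otimes> b) \<otimes> (d' \<otimes> d) \<oplus> (c' \<otimes> d) \<otimes> (b' \<otimes> b)"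
      by (simp add: l_distr r_distr m_ac)
    also have "\<dots> = (a \<otimes> d \<oplus> c \<otimes> b) \<otimes> (b' \<otimes> d')"
      by (simp add: eq[symmetric] l_distr r_distr m_ac)
    finally show ?thesis
      using nz by (subst fraction_eq_iff) (auto simp: fractions_def integral_iff)
  qed
  have "(a, b) \<in> fraction R a b" "(c, d) \<in> fraction R c d"
    using assms by (auto simp: fraction_def fraction_rel_def)
  then have "(\<Union>(a', b')\<in>fraction R a b. \<Union>(c', d')\<in>fraction R c d. fraction R (a' \<otimes> d' \<oplus> c' \<otimes> b') (b' \<otimes> d')) =
      fraction R (a \<otimes> d \<oplus> c \<otimes> b) (b \<otimes> d)"
    by (intro UN_fraction_const[OF _ _ 1]) (auto simp: fraction_def)
  then show ?thesis by (simp add: fraction_field_def)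
qed

lemma fraction_zero: "\<zero>\<^bsub>fraction_field R\<^esub> = fraction R \<zero> \<one>"
  and fraction_one: "\<one>\<^bsub>fraction_field R\<^esub> = fraction R \<one> \<one>"
  by (simp_all add: fraction_field_def)

lemma field_fraction_field: "field (fraction_field R)"
proof -
  let ?F = "fraction_field R"
  note [simp] = fraction_mult fraction_add fraction_zero fraction_one fraction_in_carrier
    fraction_eq_iff
  have frI: "(a, b) \<in> fractions R \<longleftrightarrow> a \<in> carrier R \<and> b \<in> carrier R \<and> b \<noteq> \<zero>" for a b
    by (auto simp: fractions_def)
  have cr: "cring ?F"
  proof (rule cringI)
    show "abelian_group ?F"
    proof (rule abelian_groupI)
      show "\<exists>Q\<in>carrier ?F. Q \<oplus>\<^bsub>?F\<^esub> P = \<zero>\<^bsub>?F\<^esub>" if "P \<in> carrier ?F" for P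
        using that
      proof (cases rule: fraction_cases)
        case (1 a b)
        then have "a \<in> carrier R" "b \<in> carrier R" "b \<noteq> \<zero>" by (auto simp: frI)
        then show ?thesis using 1
          by (intro bexI[of _ "fraction R (\<ominus> a) b"])
             (auto simp: frI integral_iff l_minus l_neg)
      qed
      show "P \<oplus>\<^bsub>?F\<^esub> Q \<in> carrier ?F" if "P \<in> carrier ?F" "Q \<in> carrier ?F" for P Q
        using that by (elim fraction_cases) (simp add: frI integral_iff)
      show "P \<oplus>\<^bsub>?F\<^esub> Q = Q \<oplus>\<^bsub>?F\<^esub> P" if "P \<in> carrier ?F" "Q \<in> carrier ?F" for P Q
        using that by (elim fraction_cases) (simp add: frI integral_iff a_comm m_comm)
      show "\<zero>\<^bsub>?F\<^esub> \<in> carrier ?F" by (simp add: frI)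
      show "\<zero>\<^bsub>?F\<^esub> \<oplus>\<^bsub>?F\<^esub> P = P" if "P \<in> carrier ?F" for P
        using that by (elim fraction_cases) (simp add: frI integral_iff)
      show "(P \<oplus>\<^bsub>?F\<^esub> Q) \<oplus>\<^bsub>?F\<^esub> S = P \<oplus>\<^bsub>?F\<^esub> (Q \<oplus>\<^bsub>?F\<^esub> S)"
        if PQS: "P \<in> carrier ?F" "Q \<in> carrier ?F" "S \<in> carrier ?F" for P Q S
      proof -
        obtain a b where P: "(a, b) \<in> fractions R" "P = fraction R a b"
          using PQS(1) by (rule fraction_cases)
        obtain c d where Q: "(c, d) \<in> fractions R" "Q = fraction R c d"
          using PQS(2) by (rule fraction_cases)
        obtain e f where S: "(e, f) \<in> fractions R" "S = fraction R e f"
          using PQS(3) by (rule fraction_cases)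
        from P(1) Q(1) S(1) have [simp]: "a \<in> carrier R" "b \<in> carrier R" "b \<noteq> \<zero>"
          "c \<in> carrier R" "d \<in> carrier R" "d \<noteq> \<zero>" "e \<in> carrier R" "f \<in> carrier R" "f \<noteq> \<zero>"
          by (auto simp: frI)
        have "(a \<otimes> d \<oplus> c \<otimes> b) \<otimes> f \<oplus> e \<otimes> (b \<otimes> d) = a \<otimes> (d \<otimes> f) \<oplus> (c \<otimes> f \<oplus> e \<otimes> d) \<otimes> b"
          by (simp add: l_distr r_distr a_assoc m_ac)
        then show ?thesis
          by (simp add: P(2) Q(2) S(2) frI integral_iff m_assoc del: fraction_eq_iff)
      qed
    qed
    show "comm_monoid ?F"
    proof (rule comm_monoidI)
      show "P \<otimes>\<^bsub>?F\<^esub> Q \<in> carrier ?F" if "P \<in> carrier ?F" "Q \<in> carrier ?F" for P Q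
        using that by (elim fraction_cases) (simp add: frI integral_iff)
      show "P \<otimes>\<^bsub>?F\<^esub> Q = Q \<otimes>\<^bsub>?F\<^esub> P" if "P \<in> carrier ?F" "Q \<in> carrier ?F" for P Q
        using that by (elim fraction_cases) (simp add: frI integral_iff m_comm)
      show "\<one>\<^bsub>?F\<^esub> \<in> carrier ?F" by (simp add: frI)
      show "\<one>\<^bsub>?F\<^esub> \<otimes>\<^bsub>?F\<^esub> P = P" if "P \<in> carrier ?F" for P
        using that by (elim fraction_cases) (simp add: frI integral_iff)
      show "(P \<otimes>\<^bsub>?F\<^esub> Q) \<otimes>\<^bsub>?F\<^esub> S = P \<otimes>\<^bsub>?F\<^esub> (Q \<otimes>\<^bsub>?F\<^esub> S)"
        if "P \<in> carrier ?F" "Q \<in> carrier ?F" "S \<in> carrier ?F" for P Q S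
        using that by (elim fraction_cases) (simp add: frI integral_iff m_assoc)
    qed
    show "(P \<oplus>\<^bsub>?F\<^esub> Q) \<otimes>\<^bsub>?F\<^esub> S = P \<otimes>\<^bsub>?F\<^esub> S \<oplus>\<^bsub>?F\<^esub> Q \<otimes>\<^bsub>?F\<^esub> S"
      if PQS: "P \<in> carrier ?F" "Q \<in> carrier ?F" "S \<in> carrier ?F" for P Q S
    proof -
      obtain a b where P: "(a, b) \<in> fractions R" "P = fraction R a b"
        using PQS(1) by (rule fraction_cases)
      obtain c d where Q: "(c, d) \<in> fractions R" "Q = fraction R c d"
        using PQS(2) by (rule fraction_cases)
      obtain e f where S: "(e, f) \<in> fractions R" "S = fraction R e f"
        using PQS(3) by (rule fraction_cases)
      from P(1) Q(1) S(1) have [simp]: "a \<in> carrier R" "b \<in> carrier R" "b \<noteq> \<zero>"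
        "c \<in> carrier R" "d \<in> carrier R" "d \<noteq> \<zero>" "e \<in> carrier R" "f \<in> carrier R" "f \<noteq> \<zero>"
        by (auto simp: frI)
      have "fraction R ((a \<otimes> d \<oplus> c \<otimes> b) \<otimes> e) (b \<otimes> d \<otimes> f) =
          fraction R ((a \<otimes> e) \<otimes> (d \<otimes> f) \<oplus> (c \<otimes> e) \<otimes> (b \<otimes> f)) ((b \<otimes> f) \<otimes> (d \<otimes> f))"
        by (subst fraction_eq_iff) (auto simp: frI integral_iff l_distr r_distr m_ac)
      then show ?thesis
        by (simp add: P(2) Q(2) S(2) frI integral_iff del: fraction_eq_iff)
    qed
  qed
  interpret F: cring ?F by (rule cr)
  show ?thesis
  proof (rule F.cring_fieldI2)
    show "\<zero>\<^bsub>?F\<^esub> \<noteq> \<one>\<^bsub>?F\<^esub>" by (simp add: frI)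
    show "\<exists>Q\<in>carrier ?F. P \<otimes>\<^bsub>?F\<^esub> Q = \<one>\<^bsub>?F\<^esub>"
      if P: "P \<in> carrier ?F" "P \<noteq> \<zero>\<^bsub>?F\<^esub>" for P
    proof -
      obtain a b where ab: "(a, b) \<in> fractions R" "P = fraction R a b"
        using P(1) by (rule fraction_cases)
      then have *: "a \<in> carrier R" "b \<in> carrier R" "b \<noteq> \<zero>" by (auto simp: frI)
      have "a \<noteq> \<zero>" using P(2) ab * by (auto simp: frI)
      with * show ?thesis
        by (intro bexI[of _ "fraction R b a"]) (simp_all add: ab(2) frI integral_iff m_comm)
    qed
  qed
qed

lemma fraction_embed_hom: "fraction_embed R \<in> ring_hom R (fraction_field R)"
  by (rule ring_hom_memI)
     (simp_all add: fraction_embed_def fraction_mult fraction_add fraction_one fractions_def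
        fraction_in_carrier)

lemma inj_on_fraction_embed: "inj_on (fraction_embed R) (carrier R)"
  by (rule inj_onI) (simp add: fraction_embed_def fraction_eq_iff fractions_def)

end


section \<open>The Veronese embedding\<close>

text \<open>The substitution homomorphism sending each variable \<open>v\<close> to \<open>g v\<close>.\<close>

definition substitute :: "('v \<Rightarrow> 'u cmpoly) \<Rightarrow> 'v cmpoly \<Rightarrow> 'u cmpoly" where
  "substitute g f =
     (\<Sum>m\<in>Poly_Mapping.keys f. const_poly (Poly_Mapping.lookup f m) *
        (\<Prod>v\<in>Poly_Mapping.keys m. g v ^ Poly_Mapping.lookup m v))"

lemma substitute_superset:
  assumes "finite A" "Poly_Mapping.keys f \<subseteq> A"
  shows "substitute g f = (\<Sum>m\<in>A. const_poly (Poly_Mapping.lookup f m) *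
    (\<Prod>v\<in>Poly_Mapping.keys m. g v ^ Poly_Mapping.lookup m v))"
  unfolding substitute_def using assms
  by (intro sum.mono_neutral_left) (auto simp: const_poly_def in_keys_iff)

lemma substitute_add: "substitute g (f + h) = substitute g f + substitute g h"
proof -
  let ?A = "Poly_Mapping.keys f \<union> Poly_Mapping.keys h"
  have "Poly_Mapping.keys (f + h) \<subseteq> ?A" by (rule Poly_Mapping.keys_add)
  then show ?thesis
    by (simp add: substitute_superset[of ?A] const_poly_def lookup_add single_add
        sum.distrib distrib_right)
qed

lemma substitute_const: "substitute g (const_poly c) = const_poly c"
  by (simp add: substitute_superset[of "{0}"] const_poly_def)

lemma substitute_variable: "substitute g (variable v) = g v"
  by (simp add: substitute_def variable_def monomial_def const_poly_def)

lemma substitute_mult: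
  fixes g :: "'v \<Rightarrow> 'u cmpoly"
  shows "substitute g (f * h) = substitute g f * substitute g h"
proof -
  let ?ev = "\<lambda>m. \<Prod>v\<in>Poly_Mapping.keys m. g v ^ Poly_Mapping.lookup m v"
  have ev: "?ev m = (\<Prod>v\<in>A. g v ^ Poly_Mapping.lookup m v)"
    if "finite A" "Poly_Mapping.keys m \<subseteq> A" for A m
    using that by (intro prod.mono_neutral_left) (auto simp: in_keys_iff)
  have ev_add: "?ev (a + b) = ?ev a * ?ev b" for a b
    unfolding ev[of "Poly_Mapping.keys a \<union> Poly_Mapping.keys b" a, simplified]
      ev[of "Poly_Mapping.keys a \<union> Poly_Mapping.keys b" b, simplified]
      ev[of "Poly_Mapping.keys a \<union> Poly_Mapping.keys b" "a + b", OF _ Poly_Mapping.keys_add, simplified]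
    by (simp add: lookup_add power_add prod.distrib)
  have single: "substitute g (Poly_Mapping.single m c) = const_poly c * ?ev m" for m c
    by (simp add: substitute_superset[of "{m}"])
  have const_mult: "const_poly (c * c') = const_poly c * const_poly c'" for c c'
    by (simp add: const_poly_def mult_single)
  have zero: "substitute g 0 = 0" by (simp add: substitute_def)
  have sum: "substitute g (sum F A) = (\<Sum>a\<in>A. substitute g (F a))" for F and A :: "('v \<Rightarrow>\<^sub>0 nat) set"
    by (induction A rule: infinite_finite_induct) (simp_all add: substitute_add zero)
  have decomp: "p = (\<Sum>m\<in>Poly_Mapping.keys p. Poly_Mapping.single m (Poly_Mapping.lookup p m))"
    for p :: "'v cmpoly"
    by (rule poly_mapping_eqI) (auto simp: lookup_sum lookup_single when_def in_keys_iff)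
  have "f * h = (\<Sum>m\<in>Poly_Mapping.keys f. \<Sum>k\<in>Poly_Mapping.keys h.
      Poly_Mapping.single (m + k) (Poly_Mapping.lookup f m * Poly_Mapping.lookup h k))"
    by (subst (1) decomp[of f], subst (1) decomp[of h]) (simp add: sum_product mult_single)
  then have "substitute g (f * h) = (\<Sum>m\<in>Poly_Mapping.keys f. \<Sum>k\<in>Poly_Mapping.keys h.
      (const_poly (Poly_Mapping.lookup f m) * ?ev m) *
      (const_poly (Poly_Mapping.lookup h k) * ?ev k))"
    by (simp add: sum single ev_add const_mult mult_ac)
  then show ?thesis by (simp add: sum_product substitute_def)
qed

text \<open>
  The homogeneous coordinates \<open>x\<^sub>0, \<dots>, x\<^sub>n\<close> are the variables \<open>0, \<dots>, n\<close>;
  the variable \<open>y\<^sub>a\<close> is indexed by the exponent vector \<open>a\<close> itself.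
\<close>

definition veronese_vars :: "nat \<Rightarrow> nat \<Rightarrow> (nat \<Rightarrow>\<^sub>0 nat) set" where
  "veronese_vars n d = {a. Poly_Mapping.keys a \<subseteq> {..n} \<and> total_degree a = d}"

definition veronese_map ::
    "nat \<Rightarrow> nat cmpoly set \<Rightarrow> (nat \<Rightarrow>\<^sub>0 nat) cmpoly \<Rightarrow> nat cmpoly set" where
  "veronese_map n I f = I +>\<^bsub>mpoly_ring {..n}\<^esub> substitute monomial f"

definition veronese_ideal ::
    "nat \<Rightarrow> nat \<Rightarrow> nat cmpoly set \<Rightarrow> (nat \<Rightarrow>\<^sub>0 nat) cmpoly set" where
  "veronese_ideal n d I =
     a_kernel (mpoly_ring (veronese_vars n d)) (mpoly_ring {..n} Quot I) (veronese_map n I)"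

definition projectively_normal :: "nat \<Rightarrow> nat cmpoly set \<Rightarrow> bool" where
  "projectively_normal n I \<longleftrightarrow> normal_domain (mpoly_ring {..n} Quot I)"

end

theory Submission
  imports Defs
begin

text \<open>
  Write \<open>S\<close> for the polynomial ring in \<open>x\<^sub>0, \<dots>, x\<^sub>n\<close>, \<open>T\<close> for the one in the \<open>y\<^sub>a\<close>, and
  \<open>\<phi>: T \<rightarrow> S\<close> for the substitution \<open>y\<^sub>a \<mapsto> x\<^sup>a\<close>, so that the Veronese ideal \<open>J\<close> is \<open>\<phi>\<inverse>(I)\<close>. The
  proof shows that passing to initial ideals commutes with \<open>\<phi>\<inverse>\<close> on the tropical variety.

  The tropical variety of \<open>J\<close> is small. Two monomials of \<open>T\<close> with the same image under \<open>\<phi>\<close> differ by an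
  element of \<open>J\<close>; if \<open>w\<close> gave them different weights, the initial form of this binomial would be a
  monomial. Applied to \<open>y\<^sub>a\<^sup>d\<close> and the product of the powers \<open>y\<^sub>b\<^sup>k\<close> with \<open>b = d e\<^sub>i\<close> and \<open>k = a\<^sub>i\<close>,
  whose common image is \<open>x\<close> to the power \<open>d a\<close>, this makes \<open>w\<close> linear: \<open>w\<^sub>a\<close> is the \<open>u\<close>-weight of \<open>x\<^sup>a\<close>, where
  \<open>u\<^sub>i\<close> is \<open>w\<close> at \<open>d e\<^sub>i\<close>, divided by \<open>d\<close> (\<open>Trop_veronese_weight\<close>). Hence \<open>\<phi>\<close> preserves weights.

  For such \<open>w\<close> one has \<open>in\<^sub>w(J) = \<phi>\<inverse>(in\<^sub>u(I))\<close> (\<open>initial_ideal_veronese\<close>). An initial form of an element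
  of \<open>J\<close> maps to zero or to an initial form of an element of \<open>I\<close>. Conversely let \<open>q\<close> be
  \<open>w\<close>-homogeneous and \<open>\<phi>(q)\<close> the initial form of some \<open>f \<in> I\<close>. As \<open>I\<close> is homogeneous, the terms of \<open>f\<close>
  of degree not divisible by \<open>d\<close> can be dropped, so \<open>f\<close> lifts term by term to \<open>p \<in> J\<close>; replacing the
  lowest part of \<open>p\<close> by \<open>q\<close> does not change \<open>\<phi>(p)\<close>, so \<open>q\<close> is an initial form of an element of \<open>J\<close>.

  If \<open>in\<^sub>u(I)\<close> contained a monomial, it would contain one of degree divisible by \<open>d\<close>, and a
  \<open>\<phi>\<close>-preimage of that would be a monomial in \<open>in\<^sub>w(J)\<close> (\<open>Trop_veronese_descends\<close>). So \<open>u\<close> is in the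
  tropical variety of \<open>I\<close>, \<open>in\<^sub>u(I)\<close> is prime because \<open>I\<close> is well-poised, and the preimage of a prime
  ideal is prime.
\<close>

section \<open>Monomials and their weights\<close>

lemma weight_superset:
  assumes "finite A" "Poly_Mapping.keys m \<subseteq> A"
  shows "weight w m = (\<Sum>v\<in>A. real (Poly_Mapping.lookup m v) * w v)"
  unfolding weight_def using assms
  by (intro sum.mono_neutral_left) (auto simp: in_keys_iff)

lemma weight_zero [simp]: "weight w 0 = 0"
  by (simp add: weight_def)

lemma weight_add: "weight w (a + b) = weight w a + weight w b"
proof -
  let ?A = "Poly_Mapping.keys a \<union> Poly_Mapping.keys b"
  have "Poly_Mapping.keys (a + b) \<subseteq> ?A" by (rule Poly_Mapping.keys_add)
  then show ?thesis
    by (simp add: weight_superset[of ?A] lookup_add sum.distrib distrib_right)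
qed

lemma weight_single [simp]: "weight w (Poly_Mapping.single v k) = real k * w v"
  by (simp add: weight_superset[of "{v}"])

lemma weight_sum: "weight w (sum F A) = (\<Sum>a\<in>A. weight w (F a))"
  by (induction A rule: infinite_finite_induct) (simp_all add: weight_add)

text \<open>
  The degree is a weight, and so inherits additivity from the lemmas above.
\<close>

lemma real_total_degree: "real (total_degree m) = weight (\<lambda>_. 1) m"
  by (simp add: weight_def total_degree_def)

lemma total_degree_zero [simp]: "total_degree 0 = 0"
  by (simp add: total_degree_def)

lemma total_degree_add: "total_degree (a + b) = total_degree a + total_degree b"
  using weight_add[of "\<lambda>_. 1" a b] unfolding real_total_degree[symmetric] by linarith

lemma total_degree_single [simp]: "total_degree (Poly_Mapping.single v k) = k"
  using weight_single[of "\<lambda>_. 1" v k] unfolding real_total_degree[symmetric] by simp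

lemma total_degree_sum: "total_degree (sum F A) = (\<Sum>a\<in>A. total_degree (F a))"
  by (induction A rule: infinite_finite_induct) (simp_all add: total_degree_add)

lemma keys_add_nat:
  "Poly_Mapping.keys (a + b) = Poly_Mapping.keys a \<union> Poly_Mapping.keys (b :: 'v \<Rightarrow>\<^sub>0 nat)"
  by (auto simp: in_keys_iff lookup_add)

lemma split_off_variable:
  fixes m :: "'v \<Rightarrow>\<^sub>0 nat"
  assumes "m \<noteq> 0"
  obtains v m' where "m = Poly_Mapping.single v 1 + m'"
proof -
  from assms obtain v where v: "v \<in> Poly_Mapping.keys m"
    by (metis keys_eq_empty ex_in_conv)
  have "m = Poly_Mapping.single v 1 + (m - Poly_Mapping.single v 1)"
    using v by (intro poly_mapping_eqI)
      (auto simp: lookup_add lookup_minus lookup_single when_def in_keys_iff)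
  then show thesis by (rule that)
qed

lemma split_by_degree:
  assumes "k \<le> total_degree m"
  shows "\<exists>a b. m = a + b \<and> total_degree a = k"
  using assms
proof (induction k)
  case 0
  show ?case by (intro exI[of _ 0] exI[of _ m]) simp
next
  case (Suc k)
  then obtain a b where ab: "m = a + b" "total_degree a = k" by auto
  with Suc.prems have "b \<noteq> 0" by (auto simp: total_degree_add)
  then obtain v b' where "b = Poly_Mapping.single v 1 + b'" by (rule split_off_variable)
  with ab show ?case
    by (intro exI[of _ "a + Poly_Mapping.single v 1"] exI[of _ b'])
       (simp add: total_degree_add add.assoc)
qed

lemma keys_sum_subset:
  fixes F :: "'a \<Rightarrow> 'u \<Rightarrow>\<^sub>0 'b::comm_monoid_add"
  assumes "\<And>a. a \<in> A \<Longrightarrow> Poly_Mapping.keys (F a) \<subseteq> B"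
  shows "Poly_Mapping.keys (sum F A) \<subseteq> B"
  using assms
proof (induction A rule: infinite_finite_induct)
  case (insert a A)
  then have "Poly_Mapping.keys (F a) \<union> Poly_Mapping.keys (sum F A) \<subseteq> B" by simp
  then show ?case using insert.hyps Poly_Mapping.keys_add[of "F a" "sum F A"] by auto
qed auto

lemma monomial_zero: "monomial 0 = 1"
  by (simp add: monomial_def)

lemma monomial_add: "monomial (a + b) = monomial a * monomial b"
  by (simp add: monomial_def mult_single)

lemma monomial_sum: "monomial (sum F A) = (\<Prod>a\<in>A. monomial (F a))"
  by (induction A rule: infinite_finite_induct) (simp_all add: monomial_add monomial_zero)

lemma single_in_mpoly_ring:
  "Poly_Mapping.keys m \<subseteq> V \<Longrightarrow> Poly_Mapping.single m c \<in> carrier (mpoly_ring V)"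
  by (auto simp: mem_mpoly_ring)

lemma monomial_in_mpoly_ring: "Poly_Mapping.keys m \<subseteq> V \<Longrightarrow> monomial m \<in> carrier (mpoly_ring V)"
  unfolding monomial_def by (rule single_in_mpoly_ring)


section \<open>Parts of a polynomial\<close>

text \<open>
  Both \<^const>\<open>initial_form\<close> and \<^const>\<open>homogeneous_component\<close> keep the terms of a polynomial
  whose exponents satisfy some predicate; the predicate is abstracted here.
\<close>

definition part :: "(('v \<Rightarrow>\<^sub>0 nat) \<Rightarrow> bool) \<Rightarrow> 'v cmpoly \<Rightarrow> 'v cmpoly" where
  "part P f =
     (\<Sum>m\<in>{m \<in> Poly_Mapping.keys f. P m}. Poly_Mapping.single m (Poly_Mapping.lookup f m))"

lemma lookup_part: "Poly_Mapping.lookup (part P f) m = (if P m then Poly_Mapping.lookup f m else 0)"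
  by (auto simp: part_def lookup_sum lookup_single when_def in_keys_iff)

lemma keys_part: "Poly_Mapping.keys (part P f) = {m \<in> Poly_Mapping.keys f. P m}"
  by (auto simp: in_keys_iff lookup_part split: if_splits)

lemma part_add: "part P (f + g) = part P f + part P g"
  by (rule poly_mapping_eqI) (simp add: lookup_part lookup_add)

lemma part_diff: "part P (f - g) = part P f - part P g"
  by (rule poly_mapping_eqI) (simp add: lookup_part lookup_minus)

lemma part_zero [simp]: "part P 0 = 0"
  by (rule poly_mapping_eqI) (simp add: lookup_part)

lemma part_sum: "part P (sum F A) = (\<Sum>a\<in>A. part P (F a))"
  by (induction A rule: infinite_finite_induct) (simp_all add: part_add)

lemma part_part: "part P (part Q f) = part (\<lambda>m. P m \<and> Q m) f"
  by (rule poly_mapping_eqI) (simp add: lookup_part)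

lemma part_id: "(\<And>m. m \<in> Poly_Mapping.keys f \<Longrightarrow> P m) \<Longrightarrow> part P f = f"
  by (rule poly_mapping_eqI) (auto simp: lookup_part in_keys_iff)

lemma part_single: "part P (Poly_Mapping.single m c) = (if P m then Poly_Mapping.single m c else 0)"
  by (rule poly_mapping_eqI) (auto simp: lookup_part lookup_single when_def)

lemma part_cong:
  "(\<And>m. m \<in> Poly_Mapping.keys f \<Longrightarrow> P m = Q m) \<Longrightarrow> part P f = part Q f"
  by (rule poly_mapping_eqI) (auto simp: lookup_part in_keys_iff)

lemma part_in_mpoly_ring: "f \<in> carrier (mpoly_ring V) \<Longrightarrow> part P f \<in> carrier (mpoly_ring V)"
  by (auto simp: mem_mpoly_ring keys_part)

lemma poly_sum_singles:
  "f = (\<Sum>m\<in>Poly_Mapping.keys f. Poly_Mapping.single m (Poly_Mapping.lookup f m))"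
  by (rule poly_mapping_eqI) (auto simp: lookup_sum lookup_single when_def in_keys_iff)

lemma part_single_mult:
  fixes f :: "'v cmpoly"
  shows "part P (Poly_Mapping.single a c * f) = Poly_Mapping.single a c * part (\<lambda>m. P (a + m)) f"
proof -
  have "part P (Poly_Mapping.single a c * f) = (\<Sum>m\<in>Poly_Mapping.keys f.
      Poly_Mapping.single a c * part (\<lambda>m. P (a + m)) (Poly_Mapping.single m (Poly_Mapping.lookup f m)))"
    by (subst poly_sum_singles[of f])
       (auto simp: sum_distrib_left mult_single part_sum part_single intro!: sum.cong)
  also have "\<dots> = Poly_Mapping.single a c * part (\<lambda>m. P (a + m)) f"
    by (subst (3) poly_sum_singles[of f]) (simp add: part_sum sum_distrib_left)
  finally show ?thesis .
qed

abbreviation weight_part :: "('v \<Rightarrow> real) \<Rightarrow> real \<Rightarrow> 'v cmpoly \<Rightarrow> 'v cmpoly" where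
  "weight_part w c \<equiv> part (\<lambda>m. weight w m = c)"

lemma sum_weight_parts:
  "f = (\<Sum>c\<in>weight w ` Poly_Mapping.keys f. weight_part w c f)"
  by (rule poly_mapping_eqI) (auto simp: lookup_sum lookup_part in_keys_iff)


section \<open>Initial ideals weight by weight\<close>

lemma ideal_mpoly_ringI:
  assumes "I \<subseteq> carrier (mpoly_ring V)" "0 \<in> I"
    and "\<And>f g. f \<in> I \<Longrightarrow> g \<in> I \<Longrightarrow> f + g \<in> I"
    and "\<And>f g. f \<in> carrier (mpoly_ring V) \<Longrightarrow> g \<in> I \<Longrightarrow> f * g \<in> I"
  shows "ideal I (mpoly_ring V)"
proof -
  interpret R: cring "mpoly_ring V" by (rule cring_mpoly_ring)
  have minus: "\<ominus>\<^bsub>mpoly_ring V\<^esub> f \<in> I" if "f \<in> I" for f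
  proof -
    have "f \<in> carrier (mpoly_ring V)" using that assms(1) by blast
    then have "\<ominus>\<^bsub>mpoly_ring V\<^esub> f = (\<ominus>\<^bsub>mpoly_ring V\<^esub> \<one>\<^bsub>mpoly_ring V\<^esub>) \<otimes>\<^bsub>mpoly_ring V\<^esub> f"
      by (simp only: R.l_minus[OF R.one_closed] R.l_one)
    also have "\<dots> \<in> I"
      using assms(4)[OF R.a_inv_closed[OF R.one_closed] that] by simp
    finally show ?thesis .
  qed
  show ?thesis
  proof (rule idealI)
    show "subgroup I (add_monoid (mpoly_ring V))"
      by (rule R.add.subgroupI) (use assms minus in \<open>auto simp: a_inv_def\<close>)
    show "a \<otimes>\<^bsub>mpoly_ring V\<^esub> x \<in> I" if "a \<in> I" "x \<in> carrier (mpoly_ring V)" for a x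
      using assms(4)[OF that(2,1)] by (simp add: mult.commute)
  qed (use assms in \<open>auto simp: R.ring_axioms\<close>)
qed

lemma
  assumes "ideal I (mpoly_ring V)"
  shows ideal_mpoly_ring_subset: "I \<subseteq> carrier (mpoly_ring V)"
    and ideal_mpoly_ring_zero: "0 \<in> I"
    and ideal_mpoly_ring_add: "f \<in> I \<Longrightarrow> g \<in> I \<Longrightarrow> f + g \<in> I"
    and ideal_mpoly_ring_mult: "h \<in> carrier (mpoly_ring V) \<Longrightarrow> g \<in> I \<Longrightarrow> h * g \<in> I"
    and ideal_mpoly_ring_sum: "(\<And>a. a \<in> A \<Longrightarrow> F a \<in> I) \<Longrightarrow> sum F A \<in> I"
proof -
  interpret ideal I "mpoly_ring V" by fact
  show "I \<subseteq> carrier (mpoly_ring V)" using Icarr by blast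
  show zero: "0 \<in> I" using additive_subgroup.zero_closed[OF is_additive_subgroup] by simp
  show add: "f + g \<in> I" if "f \<in> I" "g \<in> I" for f g using additive_subgroup.a_closed[OF is_additive_subgroup that] by simp
  show "h * g \<in> I" if "h \<in> carrier (mpoly_ring V)" "g \<in> I" using I_l_closed[OF that(2,1)] by simp
  show "sum F A \<in> I" if "\<And>a. a \<in> A \<Longrightarrow> F a \<in> I" 
    using that by (induction A rule: infinite_finite_induct) (auto intro: zero add)
qed

lemma initial_form_is_weight_part:
  assumes "f \<noteq> 0"
  obtains c where "initial_form w f = weight_part w c f"
    "\<And>m. m \<in> Poly_Mapping.keys f \<Longrightarrow> c \<le> weight w m"
proof -
  let ?c = "Min (weight w ` Poly_Mapping.keys f)"
  have c: "?c \<le> weight w m" if "m \<in> Poly_Mapping.keys f" for m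
    using that by (intro Min_le) auto
  have "?c \<in> weight w ` Poly_Mapping.keys f"
    using assms by (intro Min_in) auto
  then obtain m0 where "m0 \<in> Poly_Mapping.keys f" "weight w m0 = ?c" by force
  then have "initial_form w f = weight_part w ?c f"
    unfolding initial_form_def part_def[symmetric] using c
    by (intro part_cong) (metis antisym)
  then show thesis using c by (rule that)
qed

lemma weight_part_is_initial_form:
  assumes "\<And>m. m \<in> Poly_Mapping.keys f \<Longrightarrow> c \<le> weight w m" "weight_part w c f \<noteq> 0"
  shows "weight_part w c f = initial_form w f"
proof -
  have "Poly_Mapping.keys (weight_part w c f) \<noteq> {}" using assms(2) by simp
  then obtain m where "m \<in> Poly_Mapping.keys f" "weight w m = c" by (auto simp: keys_part)
  then show ?thesis
    unfolding initial_form_def part_def[symmetric] using assms(1)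
    by (intro part_cong) (auto intro: antisym)
qed

text \<open>
  The \<open>c\<close>-th piece of the associated graded ideal of \<open>I\<close>, with respect to the filtration of the
  polynomial ring by weight. Its nonzero elements are the initial forms of weight \<open>c\<close>, but, unlike
  the set of those, it is closed under addition, since the lowest terms of a sum may cancel.
\<close>

definition leading_parts :: "('v \<Rightarrow> real) \<Rightarrow> 'v cmpoly set \<Rightarrow> real \<Rightarrow> 'v cmpoly set" where
  "leading_parts w I c =
     weight_part w c ` {f \<in> I. \<forall>m\<in>Poly_Mapping.keys f. c \<le> weight w m}"

lemma leading_partsI:
  "f \<in> I \<Longrightarrow> (\<And>m. m \<in> Poly_Mapping.keys f \<Longrightarrow> c \<le> weight w m) \<Longrightarrow> weight_part w c f = g \<Longrightarrow>
    g \<in> leading_parts w I c"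
  by (auto simp: leading_parts_def)

lemma leading_partsE:
  assumes "g \<in> leading_parts w I c"
  obtains f where "f \<in> I" "\<And>m. m \<in> Poly_Mapping.keys f \<Longrightarrow> c \<le> weight w m" "g = weight_part w c f"
  using assms by (auto simp: leading_parts_def)

context
  fixes V :: "'v set" and I :: "'v cmpoly set" and w :: "'v \<Rightarrow> real"
  assumes I: "ideal I (mpoly_ring V)"
begin

lemma initial_form_subset: "initial_form w ` I \<subseteq> carrier (mpoly_ring V)"
  using ideal_mpoly_ring_subset[OF I]
  by (auto simp: initial_form_def part_def[symmetric] intro!: part_in_mpoly_ring)

lemma ideal_initial_ideal: "ideal (initial_ideal V w I) (mpoly_ring V)"
  using ring.genideal_ideal[OF cring.axioms(1)[OF cring_mpoly_ring] initial_form_subset]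
  by (simp add: initial_ideal_def)

lemma initial_form_in_initial_ideal: "f \<in> I \<Longrightarrow> initial_form w f \<in> initial_ideal V w I"
  using ring.genideal_self[OF cring.axioms(1)[OF cring_mpoly_ring] initial_form_subset]
  by (auto simp: initial_ideal_def)

lemma leading_parts_zero: "0 \<in> leading_parts w I c"
  by (rule leading_partsI[of 0]) (use ideal_mpoly_ring_zero[OF I] in auto)

lemma leading_parts_add:
  assumes "f \<in> leading_parts w I c" "g \<in> leading_parts w I c"
  shows "f + g \<in> leading_parts w I c"
proof -
  obtain f' where f': "f' \<in> I" "\<And>m. m \<in> Poly_Mapping.keys f' \<Longrightarrow> c \<le> weight w m"
    "f = weight_part w c f'"
    using assms(1) by (rule leading_partsE) metis
  obtain g' where g': "g' \<in> I" "\<And>m. m \<in> Poly_Mapping.keys g' \<Longrightarrow> c \<le> weight w m"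
    "g = weight_part w c g'"
    using assms(2) by (rule leading_partsE) metis
  show ?thesis
  proof (rule leading_partsI)
    show "f' + g' \<in> I" using f'(1) g'(1) by (rule ideal_mpoly_ring_add[OF I])
    show "weight_part w c (f' + g') = f + g" by (simp add: part_add f'(3) g'(3))
    show "c \<le> weight w m" if "m \<in> Poly_Mapping.keys (f' + g')" for m
      using that Poly_Mapping.keys_add[of f' g'] f'(2) g'(2) by blast
  qed
qed

lemma leading_parts_sum:
  "(\<And>a. a \<in> A \<Longrightarrow> F a \<in> leading_parts w I c) \<Longrightarrow> sum F A \<in> leading_parts w I c"
  by (induction A rule: infinite_finite_induct) (auto intro: leading_parts_zero leading_parts_add)

lemma leading_parts_single_mult:
  assumes "Poly_Mapping.keys a \<subseteq> V" "g \<in> leading_parts w I (c - weight w a)"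
  shows "Poly_Mapping.single a k * g \<in> leading_parts w I c"
proof -
  obtain f where f: "f \<in> I" "\<And>m. m \<in> Poly_Mapping.keys f \<Longrightarrow> c - weight w a \<le> weight w m"
    "g = weight_part w (c - weight w a) f"
    using assms(2) by (rule leading_partsE) metis
  show ?thesis
  proof (rule leading_partsI)
    show "Poly_Mapping.single a k * f \<in> I"
      using assms(1) f(1) by (intro ideal_mpoly_ring_mult[OF I] single_in_mpoly_ring)
    have "(weight w (a + m) = c) = (weight w m = c - weight w a)" for m
      by (auto simp: weight_add)
    then show "weight_part w c (Poly_Mapping.single a k * f) = Poly_Mapping.single a k * g"
      by (simp add: part_single_mult f(3))
    show "c \<le> weight w m" if m: "m \<in> Poly_Mapping.keys (Poly_Mapping.single a k * f)" for m
    proof -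
      obtain b where "m = a + b" "b \<in> Poly_Mapping.keys f"
        using m Poly_Mapping.keys_mult[of "Poly_Mapping.single a k" f] by (auto split: if_splits)
      then show ?thesis using f(2)[of b] by (simp add: weight_add)
    qed
  qed
qed

text \<open>
  Membership in an initial ideal can be tested one weight at a time, without combinations of
  generators: the polynomials that pass the test form an ideal, because \<^const>\<open>leading_parts\<close> is
  additive and multiplication by a term only shifts the weight.
\<close>

lemma initial_ideal_iff:
  assumes f: "f \<in> carrier (mpoly_ring V)"
  shows "f \<in> initial_ideal V w I \<longleftrightarrow> (\<forall>c. weight_part w c f \<in> leading_parts w I c)"
proof
  assume *: "\<forall>c. weight_part w c f \<in> leading_parts w I c"
  have "weight_part w c f \<in> initial_ideal V w I" for c
  proof (cases "weight_part w c f = 0")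
    case True
    then show ?thesis using ideal_mpoly_ring_zero[OF ideal_initial_ideal] by simp
  next
    case False
    obtain g where g: "g \<in> I" "\<And>m. m \<in> Poly_Mapping.keys g \<Longrightarrow> c \<le> weight w m"
      "weight_part w c f = weight_part w c g"
      using *[rule_format, of c] by (rule leading_partsE) metis
    then have "weight_part w c f = initial_form w g"
      using False by (simp add: weight_part_is_initial_form)
    then show ?thesis using g(1) initial_form_in_initial_ideal by simp
  qed
  then show "f \<in> initial_ideal V w I"
    by (subst sum_weight_parts[of f w]) (intro ideal_mpoly_ring_sum[OF ideal_initial_ideal])
next
  let ?H = "{f \<in> carrier (mpoly_ring V). \<forall>c. weight_part w c f \<in> leading_parts w I c}"
  have "ideal ?H (mpoly_ring V)"
  proof (rule ideal_mpoly_ringI)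
    show "0 \<in> ?H" by (simp add: leading_parts_zero mem_mpoly_ring)
    show "f + g \<in> ?H" if "f \<in> ?H" "g \<in> ?H" for f g
      using that by (simp add: mpoly_ring_add_closed part_add leading_parts_add)
    show "f * g \<in> ?H" if f: "f \<in> carrier (mpoly_ring V)" and g: "g \<in> ?H" for f g
    proof -
      have "weight_part w c (f * g) \<in> leading_parts w I c" for c
      proof -
        have "weight_part w c (f * g) = (\<Sum>a\<in>Poly_Mapping.keys f.
            weight_part w c (Poly_Mapping.single a (Poly_Mapping.lookup f a) * g))"
          by (subst poly_sum_singles[of f]) (simp add: sum_distrib_right part_sum)
        also have "\<dots> = (\<Sum>a\<in>Poly_Mapping.keys f.
            Poly_Mapping.single a (Poly_Mapping.lookup f a) * weight_part w (c - weight w a) g)"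
          by (intro sum.cong refl)
             (simp add: part_single_mult weight_add eq_diff_eq add.commute)
        also have "\<dots> \<in> leading_parts w I c"
          using f g
          by (intro leading_parts_sum leading_parts_single_mult) (auto simp: mem_mpoly_ring)
        finally show ?thesis .
      qed
      then show ?thesis using f g by (simp add: mpoly_ring_mult_closed)
    qed
  qed auto
  moreover have "initial_form w ` I \<subseteq> ?H"
  proof clarify
    fix g assume g: "g \<in> I"
    have "weight_part w c (initial_form w g) \<in> leading_parts w I c" for c
    proof (cases "g = 0")
      case True
      then show ?thesis by (simp add: initial_form_def leading_parts_zero)
    next
      case False
      then obtain b where b: "initial_form w g = weight_part w b g"
        "\<And>m. m \<in> Poly_Mapping.keys g \<Longrightarrow> b \<le> weight w m"
        by (rule initial_form_is_weight_part) blast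
      show ?thesis
      proof (cases "b = c")
        case True
        then show ?thesis using g b by (intro leading_partsI[of g]) (auto simp: part_part)
      next
        case False
        then have "weight_part w c (initial_form w g) = 0"
          by (intro poly_mapping_eqI) (auto simp: b lookup_part)
        then show ?thesis by (simp add: leading_parts_zero)
      qed
    qed
    then show "initial_form w g \<in> carrier (mpoly_ring V) \<and>
        (\<forall>c. weight_part w c (initial_form w g) \<in> leading_parts w I c)"
      using g initial_form_subset by blast
  qed
  ultimately have "initial_ideal V w I \<subseteq> ?H"
    unfolding initial_ideal_def by (rule ring.genideal_minimal[OF cring.axioms(1)[OF cring_mpoly_ring]])
  then show "f \<in> initial_ideal V w I \<Longrightarrow> \<forall>c. weight_part w c f \<in> leading_parts w I c" by blast
qed

end

text \<open>
  A prime ideal containing a product of variables contains a factor. The constant monomial is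
  excluded because the ideal is proper.
\<close>

lemma prime_monomial_variable:
  assumes "primeideal I (mpoly_ring V)" "Poly_Mapping.keys m \<subseteq> V" "monomial m \<in> I"
  shows "\<exists>v\<in>V. variable v \<in> I"
proof -
  interpret primeideal I "mpoly_ring V" by fact
  show ?thesis
    using assms(2,3)
  proof (induction "total_degree m" arbitrary: m rule: less_induct)
    case less
    show ?case
    proof (cases "m = 0")
      case True
      then have "\<one>\<^bsub>mpoly_ring V\<^esub> \<in> I" using less.prems by (simp add: monomial_zero)
      then show ?thesis using one_imp_carrier I_notcarr by blast
    next
      case False
      then obtain v m' where m: "m = Poly_Mapping.single v 1 + m'" by (rule split_off_variable)
      then have keys: "v \<in> V" "Poly_Mapping.keys m' \<subseteq> V"
        using less.prems(1) by (auto simp: keys_add_nat)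
      have "variable v \<in> carrier (mpoly_ring V)" "monomial m' \<in> carrier (mpoly_ring V)"
        using keys by (auto simp: variable_def intro!: monomial_in_mpoly_ring)
      moreover have "variable v \<otimes>\<^bsub>mpoly_ring V\<^esub> monomial m' \<in> I"
        using less.prems(2) by (simp add: m monomial_add variable_def)
      ultimately have "variable v \<in> I \<or> monomial m' \<in> I" by (rule I_prime)
      then show ?thesis
        using less.hyps[of m'] keys by (auto simp: m total_degree_add)
    qed
  qed
qed

lemma homogeneous_dvd_part:
  assumes "homogeneous_prime_ideal V I" "f \<in> I"
  shows "part (\<lambda>m. d dvd total_degree m) f \<in> I"
proof -
  have I: "ideal I (mpoly_ring V)"
    using assms(1) by (simp add: homogeneous_prime_ideal_def primeideal_def)
  let ?A = "{k \<in> total_degree ` Poly_Mapping.keys f. d dvd k}"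
  have comp: "homogeneous_component k f = part (\<lambda>m. total_degree m = k) f" for k
    by (simp add: homogeneous_component_def part_def)
  have "part (\<lambda>m. d dvd total_degree m) f = (\<Sum>k\<in>?A. homogeneous_component k f)"
    by (rule poly_mapping_eqI) (auto simp: comp lookup_sum lookup_part in_keys_iff)
  also have "\<dots> \<in> I"
    using assms by (intro ideal_mpoly_ring_sum[OF I]) (simp add: homogeneous_prime_ideal_def)
  finally show ?thesis .
qed


section \<open>The monomial map\<close>

text \<open>
  The exponent of \<open>\<Prod> (x\<^sup>a)\<^sup>k\<close>, where \<open>k\<close> is the multiplicity of \<open>a\<close> in \<open>M\<close>. The multiple \<open>k a\<close> is
  written as a sum of \<open>k\<close> copies of \<open>a\<close>, so that additivity of weight, degree and \<^const>\<open>monomial\<close>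
  applies to it directly.
\<close>

definition veronese_exponent :: "(('u \<Rightarrow>\<^sub>0 nat) \<Rightarrow>\<^sub>0 nat) \<Rightarrow> ('u \<Rightarrow>\<^sub>0 nat)" where
  "veronese_exponent M = (\<Sum>a\<in>Poly_Mapping.keys M. \<Sum>_\<in>{..<Poly_Mapping.lookup M a}. a)"

lemma lookup_sum_copies:
  "Poly_Mapping.lookup (\<Sum>_\<in>{..<k}. a :: 'u \<Rightarrow>\<^sub>0 nat) i = k * Poly_Mapping.lookup a i"
  by (simp add: lookup_sum)

lemma veronese_exponent_superset:
  assumes "finite A" "Poly_Mapping.keys M \<subseteq> A"
  shows "veronese_exponent M = (\<Sum>a\<in>A. \<Sum>_\<in>{..<Poly_Mapping.lookup M a}. a)"
  unfolding veronese_exponent_def using assms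
  by (intro sum.mono_neutral_left) (auto simp: in_keys_iff)

lemma veronese_exponent_add:
  "veronese_exponent (M + N) = veronese_exponent M + veronese_exponent N"
proof -
  let ?A = "Poly_Mapping.keys M \<union> Poly_Mapping.keys N"
  have "Poly_Mapping.keys (M + N) \<subseteq> ?A" by (rule Poly_Mapping.keys_add)
  then show ?thesis
    by (intro poly_mapping_eqI)
       (simp add: veronese_exponent_superset[of ?A] lookup_sum lookup_add sum.distrib distrib_right)
qed

lemma veronese_exponent_zero [simp]: "veronese_exponent 0 = 0"
  by (simp add: veronese_exponent_def)

lemma veronese_exponent_single:
  "veronese_exponent (Poly_Mapping.single a k) = (\<Sum>_\<in>{..<k}. a)"
  by (simp add: veronese_exponent_superset[of "{a}"])

lemma lookup_veronese_exponent_single: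
  "Poly_Mapping.lookup (veronese_exponent (Poly_Mapping.single a k)) i = k * Poly_Mapping.lookup a i"
  by (simp only: veronese_exponent_single lookup_sum_copies)

lemma veronese_exponent_sum:
  "veronese_exponent (sum F A) = (\<Sum>a\<in>A. veronese_exponent (F a))"
  by (induction A rule: infinite_finite_induct) (simp_all add: veronese_exponent_add)

text \<open>
  A weight on the \<open>y\<^sub>a\<close> that is linear in \<open>a\<close> is preserved by the substitution.
\<close>

lemma weight_veronese_exponent:
  assumes "\<And>a. a \<in> Poly_Mapping.keys M \<Longrightarrow> w a = weight u a"
  shows "weight u (veronese_exponent M) = weight w M"
  unfolding veronese_exponent_def weight_sum weight_def[of w] using assms
  by (intro sum.cong) (auto simp: weight_sum)

lemma veronese_exponent_vars:
  assumes "Poly_Mapping.keys M \<subseteq> veronese_vars n d"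
  shows "Poly_Mapping.keys (veronese_exponent M) \<subseteq> {..n}" "d dvd total_degree (veronese_exponent M)"
proof -
  show "Poly_Mapping.keys (veronese_exponent M) \<subseteq> {..n}"
    unfolding veronese_exponent_def using assms
    by (intro keys_sum_subset) (auto simp: veronese_vars_def)
  show "d dvd total_degree (veronese_exponent M)"
    unfolding veronese_exponent_def total_degree_sum using assms
    by (intro dvd_sum) (auto simp: veronese_vars_def)
qed

text \<open>
  A monomial of degree \<open>k d\<close> is a product of \<open>k\<close> monomials of degree \<open>d\<close>.
\<close>

lemma veronese_exponent_surj:
  assumes "Poly_Mapping.keys m \<subseteq> {..n}" "total_degree m = k * d"
  shows "\<exists>M. Poly_Mapping.keys M \<subseteq> veronese_vars n d \<and> veronese_exponent M = m"
  using assms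
proof (induction k arbitrary: m)
  case 0
  have "m = 0"
  proof (rule ccontr)
    assume "m \<noteq> 0"
    then obtain v m' where "m = Poly_Mapping.single v 1 + m'" by (rule split_off_variable)
    then show False using 0 by (simp add: total_degree_add)
  qed
  then show ?case by (intro exI[of _ 0]) simp
next
  case (Suc k)
  then obtain a b where ab: "m = a + b" "total_degree a = d"
    using split_by_degree[of d m] by auto
  then have keys: "Poly_Mapping.keys a \<subseteq> {..n}" "Poly_Mapping.keys b \<subseteq> {..n}"
    using Suc.prems(1) by (auto simp: keys_add_nat)
  obtain M where "Poly_Mapping.keys M \<subseteq> veronese_vars n d" "veronese_exponent M = b"
    using Suc.IH[of b] keys ab Suc.prems(2) by (auto simp: total_degree_add)
  then show ?case
    using ab keys
    by (intro exI[of _ "Poly_Mapping.single a 1 + M"])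
       (auto simp: keys_add_nat veronese_exponent_add veronese_exponent_single veronese_vars_def)
qed

lemma substitute_zero [simp]: "substitute g 0 = 0"
  by (simp add: substitute_def)

lemma substitute_diff: "substitute g (f - h) = substitute g f - substitute g h"
  using substitute_add[of g "f - h" h] by (simp add: algebra_simps)

lemma substitute_sum: "substitute g (sum F A) = (\<Sum>a\<in>A. substitute g (F a))"
  by (induction A rule: infinite_finite_induct) (simp_all add: substitute_add)

lemma substitute_monomial_single:
  "substitute monomial (Poly_Mapping.single M c) = Poly_Mapping.single (veronese_exponent M) c"
proof -
  have "(\<Prod>v\<in>Poly_Mapping.keys M. monomial v ^ Poly_Mapping.lookup M v) =
      monomial (veronese_exponent M)"
    by (simp add: veronese_exponent_def monomial_sum)
  then show ?thesis
    by (simp add: substitute_superset[of "{M}"] const_poly_def monomial_def mult_single)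
qed

lemma substitute_monomial_monomial:
  "substitute monomial (monomial M) = monomial (veronese_exponent M)"
  by (simp add: monomial_def substitute_monomial_single)

lemma substitute_monomial_alt:
  "substitute monomial f = (\<Sum>M\<in>Poly_Mapping.keys f.
     Poly_Mapping.single (veronese_exponent M) (Poly_Mapping.lookup f M))"
  by (subst poly_sum_singles[of f]) (simp only: substitute_sum substitute_monomial_single)

lemma keys_substitute_monomial:
  "Poly_Mapping.keys (substitute monomial f) \<subseteq> veronese_exponent ` Poly_Mapping.keys f"
  unfolding substitute_monomial_alt by (rule keys_sum_subset) auto

lemma part_substitute_monomial:
  "part P (substitute monomial f) = substitute monomial (part (\<lambda>M. P (veronese_exponent M)) f)"
proof -
  have "substitute monomial (part (\<lambda>M. P (veronese_exponent M)) f) = (\<Sum>M\<in>Poly_Mapping.keys f.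
      substitute monomial (part (\<lambda>M. P (veronese_exponent M))
        (Poly_Mapping.single M (Poly_Mapping.lookup f M))))"
    by (subst poly_sum_singles[of f]) (simp only: part_sum substitute_sum)
  also have "\<dots> = part P (substitute monomial f)"
    unfolding substitute_monomial_alt part_sum
    by (intro sum.cong refl) (simp add: part_single substitute_monomial_single)
  finally show ?thesis ..
qed

lemma ring_hom_substitute_monomial:
  "ring_hom_ring (mpoly_ring (veronese_vars n d)) (mpoly_ring {..n}) (substitute monomial)"
proof (rule ring_hom_ringI)
  show "substitute monomial f \<in> carrier (mpoly_ring {..n})"
    if "f \<in> carrier (mpoly_ring (veronese_vars n d))" for f
    using that keys_substitute_monomial[of f] veronese_exponent_vars(1)
    by (fastforce simp: mem_mpoly_ring)
  show "substitute monomial \<one>\<^bsub>mpoly_ring (veronese_vars n d)\<^esub> = \<one>\<^bsub>mpoly_ring {..n}\<^esub>"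
    using substitute_monomial_monomial[of 0] by (simp add: monomial_zero)
qed (simp_all add: substitute_add substitute_mult cring.axioms(1)[OF cring_mpoly_ring])

lemma veronese_preimage_primeideal:
  assumes "primeideal I (mpoly_ring {..n})"
  shows "primeideal {f \<in> carrier (mpoly_ring (veronese_vars n d)). substitute monomial f \<in> I}
    (mpoly_ring (veronese_vars n d))"
  using ring_hom_ring.primeideal_vimage[OF ring_hom_substitute_monomial cring_mpoly_ring assms] .

text \<open>
  Choosing one monomial over each term of \<open>f\<close> gives a lift without cancelling terms. Such a lift has
  no terms of lower weight than \<open>f\<close>, which an arbitrary preimage could have.
\<close>

lemma veronese_lift:
  assumes "f \<in> carrier (mpoly_ring {..n})" "\<And>m. m \<in> Poly_Mapping.keys f \<Longrightarrow> d dvd total_degree m"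
  obtains g where "g \<in> carrier (mpoly_ring (veronese_vars n d))" "substitute monomial g = f"
    "veronese_exponent ` Poly_Mapping.keys g \<subseteq> Poly_Mapping.keys f"
proof -
  have "\<exists>M. Poly_Mapping.keys M \<subseteq> veronese_vars n d \<and> veronese_exponent M = m"
    if m: "m \<in> Poly_Mapping.keys f" for m
  proof -
    obtain k where "total_degree m = k * d" using assms(2)[OF m] by (metis dvd_def mult.commute)
    then show ?thesis using assms(1) m by (intro veronese_exponent_surj) (auto simp: mem_mpoly_ring)
  qed
  then obtain L where L: "\<And>m. m \<in> Poly_Mapping.keys f \<Longrightarrow>
      Poly_Mapping.keys (L m) \<subseteq> veronese_vars n d \<and> veronese_exponent (L m) = m"
    by metis
  let ?g = "\<Sum>m\<in>Poly_Mapping.keys f. Poly_Mapping.single (L m) (Poly_Mapping.lookup f m)"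
  have keys: "Poly_Mapping.keys ?g \<subseteq> L ` Poly_Mapping.keys f"
    by (rule keys_sum_subset) auto
  show thesis
  proof (rule that)
    show "?g \<in> carrier (mpoly_ring (veronese_vars n d))" using keys L by (fastforce simp: mem_mpoly_ring)
    show "veronese_exponent ` Poly_Mapping.keys ?g \<subseteq> Poly_Mapping.keys f" using keys L by fastforce
    have "substitute monomial ?g =
        (\<Sum>m\<in>Poly_Mapping.keys f. Poly_Mapping.single m (Poly_Mapping.lookup f m))"
      unfolding substitute_sum substitute_monomial_single using L by (intro sum.cong) auto
    then show "substitute monomial ?g = f" using poly_sum_singles[of f] by simp
  qed
qed


section \<open>Initial ideals of the Veronese ideal\<close>

lemma veronese_ideal_eq:
  assumes "ideal I (mpoly_ring {..n})"
  shows "veronese_ideal n d I =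
    {f \<in> carrier (mpoly_ring (veronese_vars n d)). substitute monomial f \<in> I}"
proof -
  interpret S: cring "mpoly_ring {..n}" by (rule cring_mpoly_ring)
  have "I +>\<^bsub>mpoly_ring {..n}\<^esub> g = I \<longleftrightarrow> g \<in> I" if "g \<in> carrier (mpoly_ring {..n})" for g
    using S.a_rcos_zero[OF assms] ideal.rcos_const_imp_mem[OF assms that] by blast
  moreover have "substitute monomial f \<in> carrier (mpoly_ring {..n})"
    if "f \<in> carrier (mpoly_ring (veronese_vars n d))" for f
  proof -
    interpret ring_hom_ring "mpoly_ring (veronese_vars n d)" "mpoly_ring {..n}" "substitute monomial"
      by (rule ring_hom_substitute_monomial)
    show ?thesis using that by (rule hom_closed)
  qed
  ultimately show ?thesis
    by (auto simp: veronese_ideal_def a_kernel_def' veronese_map_def FactRing_def)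
qed

text \<open>
  Otherwise the initial form of the binomial would be plus or minus one of its two monomials.
\<close>

lemma Trop_weight_eq:
  assumes "ideal J (mpoly_ring V)" "w \<in> Trop V J"
    and "Poly_Mapping.keys M \<subseteq> V" "Poly_Mapping.keys N \<subseteq> V" "monomial M - monomial N \<in> J"
  shows "weight w M = weight w N"
proof -
  have False if less: "weight w M < weight w N" and keys: "Poly_Mapping.keys M \<subseteq> V"
    and mem: "f \<in> J" and f: "f = Poly_Mapping.single M c - Poly_Mapping.single N c"
    and c: "c * c = 1" for M N c f
  proof -
    have ne: "M \<noteq> N" and c0: "c \<noteq> 0" using less c by auto
    then have "Poly_Mapping.keys f = {M, N}"
      by (auto simp: f in_keys_iff lookup_minus lookup_single when_def split: if_splits)
    then have "initial_form w f = part (\<lambda>m. m = M) f"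
      unfolding initial_form_def part_def[symmetric] using less by (intro part_cong) auto
    then have "initial_form w f = Poly_Mapping.single M c"
      using ne by (auto simp: f part_diff part_single)
    moreover have "initial_form w f \<in> initial_ideal V w J"
      using mem by (rule initial_form_in_initial_ideal[OF assms(1)])
    \<comment> \<open>The coefficient \<open>c\<close> is its own inverse.\<close>
    ultimately have "Poly_Mapping.single 0 c * Poly_Mapping.single M c \<in> initial_ideal V w J"
      using ideal_mpoly_ring_mult[OF ideal_initial_ideal[OF assms(1)] single_in_mpoly_ring[of 0]] by simp
    then have "monomial M \<in> initial_ideal V w J"
      by (simp add: mult_single c monomial_def)
    then show False using keys assms(2) by (auto simp: Trop_def)
  qed
  \<comment> \<open>The sign \<open>c\<close> covers both orders of the two weights without negating the binomial.\<close>
  from this[of M N _ 1] this[of N M _ "-1"] assms(3-5) show ?thesis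
    by (metis linorder_neqE_linordered_idom monomial_def mult.right_neutral mult_minus1
      minus_minus single_uminus diff_minus_eq_add add.commute uminus_add_conv_diff)
qed

text \<open>
  The binomial behind this is \<open>y\<^sub>a\<^sup>d\<close> minus the product over \<open>i\<close> of the \<open>a\<^sub>i\<close>-th powers of the variable
  indexed by \<open>d e\<^sub>i\<close>; both terms map to \<open>x\<close> to the power \<open>d a\<close>.
\<close>

lemma Trop_veronese_weight:
  assumes "ideal I (mpoly_ring {..n})" "d \<ge> 1"
    and J: "ideal (veronese_ideal n d I) (mpoly_ring (veronese_vars n d))"
    and w: "w \<in> Trop (veronese_vars n d) (veronese_ideal n d I)"
    and a: "a \<in> veronese_vars n d"
  shows "w a = weight (\<lambda>i\<in>{..n}. w (Poly_Mapping.single i d) / real d) a"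
proof -
  have keys: "Poly_Mapping.keys a \<subseteq> {..n}" using a by (simp add: veronese_vars_def)
  let ?M = "Poly_Mapping.single a d"
  let ?N = "\<Sum>i\<in>Poly_Mapping.keys a.
    Poly_Mapping.single (Poly_Mapping.single i d) (Poly_Mapping.lookup a i)"
  have M: "Poly_Mapping.keys ?M \<subseteq> veronese_vars n d" using a by simp
  have N: "Poly_Mapping.keys ?N \<subseteq> veronese_vars n d"
    using keys by (intro keys_sum_subset) (auto simp: veronese_vars_def)
  have "veronese_exponent ?M = veronese_exponent ?N"
    by (rule poly_mapping_eqI)
       (auto simp: veronese_exponent_sum lookup_sum lookup_veronese_exponent_single lookup_single
          when_def if_distrib[where f = "(*) _"] in_keys_iff cong: if_cong)
  then have "substitute monomial (monomial ?M - monomial ?N) = 0"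
    by (simp only: substitute_diff substitute_monomial_monomial) simp
  moreover have "monomial ?M - monomial ?N \<in> carrier (mpoly_ring (veronese_vars n d))"
    using M N keys_diff[of "monomial ?M" "monomial ?N"]
    unfolding mem_mpoly_ring monomial_def keys_single by fastforce
  ultimately have "monomial ?M - monomial ?N \<in> veronese_ideal n d I"
    by (simp add: veronese_ideal_eq[OF assms(1)] ideal_mpoly_ring_zero[OF assms(1)])
  then have "weight w ?M = weight w ?N" by (rule Trop_weight_eq[OF J w M N])
  then have "real d * w a = (\<Sum>i\<in>Poly_Mapping.keys a. real (Poly_Mapping.lookup a i) * w (Poly_Mapping.single i d))"
    by (simp add: weight_sum)
  also have "\<dots> = (\<Sum>i\<in>Poly_Mapping.keys a. real d * (real (Poly_Mapping.lookup a i) *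
      (\<lambda>i\<in>{..n}. w (Poly_Mapping.single i d) / real d) i))"
    using keys assms(2) by (intro sum.cong) auto
  also have "\<dots> = real d * weight (\<lambda>i\<in>{..n}. w (Poly_Mapping.single i d) / real d) a"
    by (simp add: weight_def sum_distrib_left)
  finally show ?thesis using assms(2) by simp
qed

text \<open>
  By \<open>initial_ideal_iff\<close> it is enough to compare the two sides in each weight \<open>c\<close>, as substitution
  commutes with taking the part of weight \<open>c\<close>.
\<close>

lemma initial_ideal_veronese:
  assumes hom: "homogeneous_prime_ideal {..n} I"
    and J: "ideal (veronese_ideal n d I) (mpoly_ring (veronese_vars n d))"
    and w: "\<And>a. a \<in> veronese_vars n d \<Longrightarrow> w a = weight u a"
  shows "initial_ideal (veronese_vars n d) w (veronese_ideal n d I) =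
    {q \<in> carrier (mpoly_ring (veronese_vars n d)).
       substitute monomial q \<in> initial_ideal {..n} u I}"
proof -
  let ?V = "veronese_vars n d" and ?J = "veronese_ideal n d I" and ?\<phi> = "substitute monomial"
  interpret \<phi>: ring_hom_ring "mpoly_ring ?V" "mpoly_ring {..n}" ?\<phi>
    by (rule ring_hom_substitute_monomial)
  have I: "ideal I (mpoly_ring {..n})"
    using hom by (simp add: homogeneous_prime_ideal_def primeideal_def)
  note J_eq = veronese_ideal_eq[OF I, of d]
  have weight_eq: "weight u (veronese_exponent M) = weight w M" if "Poly_Mapping.keys M \<subseteq> ?V" for M
    using that w by (intro weight_veronese_exponent) auto
  have part_eq: "weight_part u c (?\<phi> q) = ?\<phi> (weight_part w c q)"
    if "q \<in> carrier (mpoly_ring ?V)" for q c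
    unfolding part_substitute_monomial using that
    by (intro arg_cong[of _ _ ?\<phi>] part_cong) (auto simp: mem_mpoly_ring weight_eq)
  have "q \<in> initial_ideal ?V w ?J \<longleftrightarrow> ?\<phi> q \<in> initial_ideal {..n} u I"
    if q: "q \<in> carrier (mpoly_ring ?V)" for q
  proof -
    have "weight_part w c q \<in> leading_parts w ?J c \<longleftrightarrow>
        weight_part u c (?\<phi> q) \<in> leading_parts u I c" for c
    proof
      assume "weight_part w c q \<in> leading_parts w ?J c"
      then obtain p where p: "p \<in> ?J" "\<And>m. m \<in> Poly_Mapping.keys p \<Longrightarrow> c \<le> weight w m"
        "weight_part w c q = weight_part w c p"
        by (rule leading_partsE) metis
      from p(1) have p': "p \<in> carrier (mpoly_ring ?V)" "?\<phi> p \<in> I" by (auto simp: J_eq)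
      show "weight_part u c (?\<phi> q) \<in> leading_parts u I c"
      proof (rule leading_partsI)
        show "?\<phi> p \<in> I" by fact
        show "weight_part u c (?\<phi> p) = weight_part u c (?\<phi> q)"
          by (simp add: part_eq q p' p(3))
        show "c \<le> weight u m" if m: "m \<in> Poly_Mapping.keys (?\<phi> p)" for m
        proof -
          obtain M where M: "M \<in> Poly_Mapping.keys p" "m = veronese_exponent M"
            using m keys_substitute_monomial[of p] by auto
          then have "weight u m = weight w M" using p'(1) weight_eq by (auto simp: mem_mpoly_ring)
          then show ?thesis using p(2) M(1) by simp
        qed
      qed
    next
      assume "weight_part u c (?\<phi> q) \<in> leading_parts u I c"
      then obtain f where f: "f \<in> I" "\<And>m. m \<in> Poly_Mapping.keys f \<Longrightarrow> c \<le> weight u m"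
        "weight_part u c (?\<phi> q) = weight_part u c f"
        by (rule leading_partsE) metis
      \<comment> \<open>Only degrees divisible by \<open>d\<close> lift; \<open>I\<close> is homogeneous, and the part of weight \<open>c\<close>, being
        the image of a polynomial, lies in such degrees already.\<close>
      define f' where "f' = part (\<lambda>m. d dvd total_degree m) f"
      have f'I: "f' \<in> I" unfolding f'_def using hom f(1) by (rule homogeneous_dvd_part)
      have "weight_part u c f' = part (\<lambda>m. d dvd total_degree m) (weight_part u c f)"
        by (simp add: f'_def part_part conj_commute)
      also have "\<dots> = part (\<lambda>m. d dvd total_degree m) (weight_part u c (?\<phi> q))"
        by (simp add: f(3))
      also have "\<dots> = weight_part u c (?\<phi> q)"
      proof (rule part_id)
        fix m assume "m \<in> Poly_Mapping.keys (weight_part u c (?\<phi> q))"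
        then obtain M where "M \<in> Poly_Mapping.keys q" "m = veronese_exponent M"
          using keys_substitute_monomial[of q] by (auto simp: keys_part)
        then show "d dvd total_degree m"
          using q veronese_exponent_vars(2) by (auto simp: mem_mpoly_ring)
      qed
      finally have f'c: "weight_part u c f' = ?\<phi> (weight_part w c q)" by (simp add: part_eq q)
      have "f' \<in> carrier (mpoly_ring {..n})" using f'I ideal_mpoly_ring_subset[OF I] by blast
      moreover have "d dvd total_degree m" if "m \<in> Poly_Mapping.keys f'" for m
        using that by (simp add: f'_def keys_part)
      ultimately obtain p where p: "p \<in> carrier (mpoly_ring ?V)" "?\<phi> p = f'"
        "veronese_exponent ` Poly_Mapping.keys p \<subseteq> Poly_Mapping.keys f'"
        by (rule veronese_lift)
      \<comment> \<open>The lowest part of \<open>p\<close> and that of \<open>q\<close> have the same image but may differ, so the former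
        is exchanged for the latter.\<close>
      let ?p = "part (\<lambda>M. weight w M \<noteq> c) p + weight_part w c q"
      have p_split: "part (\<lambda>M. weight w M \<noteq> c) p = p - weight_part w c p"
        by (rule poly_mapping_eqI) (simp add: lookup_minus lookup_part)
      show "weight_part w c q \<in> leading_parts w ?J c"
      proof (rule leading_partsI)
        have "?\<phi> ?p = f' - ?\<phi> (weight_part w c p) + ?\<phi> (weight_part w c q)"
          by (simp add: substitute_add p_split substitute_diff p(2))
        also have "?\<phi> (weight_part w c p) = ?\<phi> (weight_part w c q)"
          using part_eq[OF p(1), of c] by (simp add: p(2) f'c)
        finally have "?\<phi> ?p = f'" by simp
        then show "?p \<in> ?J"
          using f'I p(1) q by (auto simp: J_eq intro!: mpoly_ring_add_closed part_in_mpoly_ring)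
        show "weight_part w c ?p = weight_part w c q"
          by (rule poly_mapping_eqI) (simp add: lookup_part lookup_add)
        show "c \<le> weight w M" if M: "M \<in> Poly_Mapping.keys ?p" for M
        proof -
          consider "M \<in> Poly_Mapping.keys p" | "weight w M = c"
            using M Poly_Mapping.keys_add[of "part (\<lambda>M. weight w M \<noteq> c) p" "weight_part w c q"]
            by (auto simp: keys_part)
          then show ?thesis
          proof cases
            case 1
            then have "veronese_exponent M \<in> Poly_Mapping.keys f" "Poly_Mapping.keys M \<subseteq> ?V"
              using p(1,3) by (auto simp: f'_def keys_part mem_mpoly_ring)
            then show ?thesis using f(2) weight_eq by metis
          qed simp
        qed
      qed
    qed
    then show ?thesis
      using q \<phi>.hom_closed[OF q] by (simp add: initial_ideal_iff[OF J] initial_ideal_iff[OF I])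
  qed
  then show ?thesis
    using ideal_mpoly_ring_subset[OF ideal_initial_ideal[OF J]] by blast
qed

text \<open>
  Multiplying a monomial of the initial ideal by a power of \<open>x\<^sub>0\<close> brings its degree to a multiple
  of \<open>d\<close>, so that it is the image of a monomial.
\<close>

lemma Trop_veronese_descends:
  assumes "ideal (initial_ideal {..n} u I) (mpoly_ring {..n})" "d \<ge> 1"
    and "u \<in> {..n} \<rightarrow>\<^sub>E UNIV" and w: "w \<in> Trop (veronese_vars n d) J"
    and init: "initial_ideal (veronese_vars n d) w J =
      {q \<in> carrier (mpoly_ring (veronese_vars n d)).
         substitute monomial q \<in> initial_ideal {..n} u I}"
  shows "u \<in> Trop {..n} I"
proof -
  have False if m: "Poly_Mapping.keys m \<subseteq> {..n}" "monomial m \<in> initial_ideal {..n} u I" for m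
  proof -
    let ?r = "Poly_Mapping.single 0 ((d - 1) * total_degree m)"
    have r: "Poly_Mapping.keys ?r \<subseteq> {..n}" by auto
    have "total_degree (?r + m) = total_degree m * d"
      using assms(2) by (cases d) (simp_all add: total_degree_add)
    moreover have "Poly_Mapping.keys (?r + m) \<subseteq> {..n}" using r m(1) by (simp add: keys_add_nat)
    ultimately obtain M where M: "Poly_Mapping.keys M \<subseteq> veronese_vars n d"
      "veronese_exponent M = ?r + m"
      using veronese_exponent_surj by blast
    have "monomial (?r + m) \<in> initial_ideal {..n} u I"
      unfolding monomial_add
      using ideal_mpoly_ring_mult[OF assms(1) monomial_in_mpoly_ring[OF r] m(2)] .
    then have "monomial M \<in> initial_ideal (veronese_vars n d) w J"
      using M by (simp add: init substitute_monomial_monomial monomial_in_mpoly_ring)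
    then show False using w M(1) by (auto simp: Trop_def)
  qed
  then show ?thesis using assms(3) by (auto simp: Trop_def)
qed

theorem corollary3p2:
  fixes n d :: nat and I :: "nat cmpoly set"
  assumes "homogeneous_prime_ideal {..n} I"
    and "projectively_normal n I"
    and "well_poised {..n} I"
    and "d \<ge> 1"
  shows "well_poised (veronese_vars n d) (veronese_ideal n d I)"
proof -
  let ?V = "veronese_vars n d" and ?J = "veronese_ideal n d I"
  have I_prime: "primeideal I (mpoly_ring {..n})"
    using assms(3) by (simp add: well_poised_def)
  then have I: "ideal I (mpoly_ring {..n})" by (simp add: primeideal_def)
  note J_eq = veronese_ideal_eq[OF I, of d]
  have J_prime: "primeideal ?J (mpoly_ring ?V)"
    unfolding J_eq using I_prime by (rule veronese_preimage_primeideal)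
  then have J: "ideal ?J (mpoly_ring ?V)" by (simp add: primeideal_def)
  have "variable a \<notin> ?J" if "a \<in> ?V" for a
  proof
    assume "variable a \<in> ?J"
    then have "monomial a \<in> I" by (simp add: J_eq substitute_variable)
    moreover have "Poly_Mapping.keys a \<subseteq> {..n}" using that by (simp add: veronese_vars_def)
    ultimately show False
      using prime_monomial_variable[OF I_prime] assms(3) by (auto simp: well_poised_def)
  qed
  moreover have "primeideal (initial_ideal ?V w ?J) (mpoly_ring ?V)" if w: "w \<in> Trop ?V ?J" for w
  proof -
    define u where "u = (\<lambda>i\<in>{..n}. w (Poly_Mapping.single i d) / real d)"
    have init: "initial_ideal ?V w ?J =
        {q \<in> carrier (mpoly_ring ?V). substitute monomial q \<in> initial_ideal {..n} u I}"
      using assms(1) J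
    proof (rule initial_ideal_veronese)
      show "w a = weight u a" if "a \<in> ?V" for a
        unfolding u_def using I assms(4) J w that by (rule Trop_veronese_weight)
    qed
    have "u \<in> {..n} \<rightarrow>\<^sub>E UNIV" by (auto simp: u_def)
    from Trop_veronese_descends[OF ideal_initial_ideal[OF I] assms(4) this w init]
    have "primeideal (initial_ideal {..n} u I) (mpoly_ring {..n})"
      using assms(3) by (simp add: well_poised_def)
    then show ?thesis unfolding init by (rule veronese_preimage_primeideal)
  qed
  ultimately show ?thesis using J_prime by (simp add: well_poised_def)
qed

end
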